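(* Let $r$ be an even integer and let $n$ be a positive integer. Then \[ F_{3r}\sum_{k=1}^n L_{2rk}^3 = F_{rn}L_{rn+r}\left(5L_{rn}F_{rn+r}F_{2rn+r}+4(L_{2r}+1)\right). \]
   Context: The Fibonacci numbers $F_m$ and Lucas numbers $L_m$ are defined for all $m\in\mathbb{Z}$ by $F_m=F_{m-1}+F_{m-2}$, $F_0=0$, $F_1=1$, and $L_m=L_{m-1}+L_{m-2}$, $L_0=2$, $L_1=1$; in particular $F_{-m}=(-1)^{m-1}F_m$ and $L_{-m}=(-1)^mL_m$. *)

theory Defs
  imports "HOL-Number_Theory.Fib"
begin

text \<open>
  The library's \<^const>\<open>fib\<close> has type \<^typ>\<open>nat \<Rightarrow> nat\<close>; the recurrence
  is run backwards to reach negative indices, which gives the signs in the definitions below.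
  The lemmas \<open>Fib_rec\<close>, \<open>Fib_unique\<close>, \<open>Luc_rec\<close> and \<open>Luc_unique\<close> show that these are
  exactly the two-sided sequences determined by the recurrence and its two initial values.
\<close>

definition Fib :: "int \<Rightarrow> int" where
  "Fib m = (if 0 \<le> m then int (fib (nat m)) else (- 1) ^ (nat (- m) + 1) * int (fib (nat (- m))))"

fun luc :: "nat \<Rightarrow> nat" where
  "luc 0 = 2"
| "luc (Suc 0) = 1"
| "luc (Suc (Suc n)) = luc (Suc n) + luc n"

definition Luc :: "int \<Rightarrow> int" where
  "Luc m = (if 0 \<le> m then int (luc (nat m)) else (- 1) ^ nat (- m) * int (luc (nat (- m))))"

lemma Fib_0 [simp]: "Fib 0 = 0" and Fib_1 [simp]: "Fib 1 = 1"
  by (simp_all add: Fib_def)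

lemma Luc_0 [simp]: "Luc 0 = 2" and Luc_1 [simp]: "Luc 1 = 1"
  by (simp_all add: Luc_def)

lemma int_cases_ge2:
  fixes m :: int
  obtains (ge2) n where "m = int n + 2" | (one) "m = 1" | (le0) n where "m = - int n"
proof -
  consider "m \<ge> 2" | "m = 1" | "m \<le> 0" by linarith
  then show thesis
  proof cases
    case 1
    then show thesis using ge2[of "nat (m - 2)"] by simp
  next
    case 2
    then show thesis by (rule one)
  next
    case 3
    then show thesis using le0[of "nat (- m)"] by simp
  qed
qed

lemma Fib_of_nat: "Fib (int n) = int (fib n)"
  by (simp add: Fib_def)

lemma Luc_of_nat: "Luc (int n) = int (luc n)"
  by (simp add: Luc_def)

lemma Fib_minus_of_nat: "Fib (- int n) = (- 1) ^ (n + 1) * int (fib n)"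
  by (cases n) (simp_all add: Fib_def nat_add_distrib)

lemma Luc_minus_of_nat: "Luc (- int n) = (- 1) ^ n * int (luc n)"
  by (cases n) (simp_all add: Luc_def nat_add_distrib)

lemma Fib_rec: "Fib m = Fib (m - 1) + Fib (m - 2)"
proof (cases m rule: int_cases_ge2)
  case (ge2 n)
  have "m = int (Suc (Suc n))" "m - 1 = int (Suc n)" "m - 2 = int n"
    using ge2 by simp_all
  then show ?thesis by (simp only: Fib_of_nat) simp
next
  case one
  then show ?thesis using Fib_minus_of_nat[of 1] by simp
next
  case (le0 n)
  have "m - 1 = - int (Suc n)" "m - 2 = - int (Suc (Suc n))"
    using le0 by simp_all
  with le0 show ?thesis by (simp only: Fib_minus_of_nat) (simp add: algebra_simps)
qed

lemma Luc_rec: "Luc m = Luc (m - 1) + Luc (m - 2)"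
proof (cases m rule: int_cases_ge2)
  case (ge2 n)
  have "m = int (Suc (Suc n))" "m - 1 = int (Suc n)" "m - 2 = int n"
    using ge2 by simp_all
  then show ?thesis by (simp only: Luc_of_nat) simp
next
  case one
  then show ?thesis using Luc_minus_of_nat[of 1] by simp
next
  case (le0 n)
  have "m - 1 = - int (Suc n)" "m - 2 = - int (Suc (Suc n))"
    using le0 by simp_all
  with le0 show ?thesis by (simp only: Luc_minus_of_nat) (simp add: algebra_simps)
qed

lemma two_sided_rec_unique:
  fixes f g :: "int \<Rightarrow> int"
  assumes f: "\<And>m. f m = f (m - 1) + f (m - 2)" and g: "\<And>m. g m = g (m - 1) + g (m - 2)"
    and 0: "f 0 = g 0" and 1: "f 1 = g 1"
  shows "f = g"
proof
  fix m :: int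
  have "f m = g m \<and> f (m + 1) = g (m + 1)"
  proof (induction m rule: int_induct[of _ 0])
    case base
    show ?case using 0 1 by simp
  next
    case (step1 i)
    then show ?case using f[of "i + 2"] g[of "i + 2"] by (simp add: algebra_simps)
  next
    case (step2 i)
    then show ?case using f[of "i + 1"] g[of "i + 1"] by simp
  qed
  then show "f m = g m" ..
qed

lemma Fib_unique:
  assumes "\<And>m. f m = f (m - 1) + f (m - 2)" "f 0 = 0" "f 1 = 1"
  shows "f = Fib"
  by (rule two_sided_rec_unique[OF assms(1) Fib_rec]) (simp_all add: assms(2,3))

lemma Luc_unique:
  assumes "\<And>m. f m = f (m - 1) + f (m - 2)" "f 0 = 2" "f 1 = 1"
  shows "f = Luc"
  by (rule two_sided_rec_unique[OF assms(1) Luc_rec]) (simp_all add: assms(2,3))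

end

theory Submission
  imports Defs
begin

text \<open>
  For even \<open>v\<close> the product-to-sum formulas \<open>Fib_times_Luc\<close>, \<open>five_Fib_times_Fib\<close> and
  \<open>Luc_times_Luc\<close> carry no signs, and they make both sides of the theorem polynomials in
  few quantities. Put \<open>s = 2 r n + r\<close>.

  On the left, \<open>Luc_cubed\<close> splits the sum of cubes into the sum of the \<open>Luc (6 r k)\<close> and three
  times the sum of the \<open>Luc (2 r k)\<close>. These sums telescope after multiplication by
  \<open>Fib (3 r)\<close> and \<open>Fib r\<close> respectively (\<open>Fib_times_sum_Luc\<close>), and
  \<open>Fib (3 r) = Fib r * (Luc (2 r) + 1)\<close>, so that \<open>Fib (3 r)\<close> serves for both. The left side is
  therefore \<open>Fib (3 s) + 3 (Luc (2 r) + 1) Fib s - 4 Fib (3 r)\<close>.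

  On the right, \<open>Fib (r n) * Luc (r n + r) = Fib s - Fib r\<close> and
  \<open>Luc (r n) * Fib (r n + r) = Fib s + Fib r\<close>. With \<open>5 (Fib r)\<^sup>2 = Luc (2 r) - 2\<close> and
  \<open>Fib (3 s) = 5 (Fib s)^3 + 3 Fib s\<close> the product expands to the same expression.
\<close>

lemma Fib_uminus_even: "even m \<Longrightarrow> Fib (- m) = - Fib m"
  by (cases m rule: int_cases2) (simp_all add: Fib_minus_of_nat Fib_of_nat)

lemma Fib_uminus_odd: "odd m \<Longrightarrow> Fib (- m) = Fib m"
  by (cases m rule: int_cases2) (simp_all add: Fib_minus_of_nat Fib_of_nat)

lemma Luc_uminus_even: "even m \<Longrightarrow> Luc (- m) = Luc m"
  by (cases m rule: int_cases2) (simp_all add: Luc_minus_of_nat Luc_of_nat)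

lemma Luc_uminus_odd: "odd m \<Longrightarrow> Luc (- m) = - Luc m"
  by (cases m rule: int_cases2) (simp_all add: Luc_minus_of_nat Luc_of_nat)

lemma Luc_eq_Fib_plus_Fib: "Luc m = Fib (m + 1) + Fib (m - 1)"
proof -
  have "(\<lambda>m. Fib (m + 1) + Fib (m - 1)) = Luc"
  proof (rule Luc_unique)
    fix m
    show "Fib (m + 1) + Fib (m - 1) =
        (Fib (m - 1 + 1) + Fib (m - 1 - 1)) + (Fib (m - 2 + 1) + Fib (m - 2 - 1))"
      using Fib_rec[of "m + 1"] Fib_rec[of "m - 1"] by (simp add: algebra_simps)
  next
    show "Fib (0 + 1) + Fib (0 - 1) = 2"
      using Fib_uminus_odd[of 1] by simp
  next
    show "Fib (1 + 1) + Fib (1 - 1) = 1"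
      using Fib_rec[of 2] by simp
  qed
  then show ?thesis by (rule fun_cong[THEN sym])
qed

lemma five_Fib_eq_Luc_plus_Luc: "5 * Fib m = Luc (m + 1) + Luc (m - 1)"
  using Fib_rec[of "m + 2"] Fib_rec[of "m + 1"] Fib_rec[of m]
  by (simp add: Luc_eq_Fib_plus_Fib algebra_simps)

text \<open>
  For fixed \<open>v\<close> both sides obey the Fibonacci recurrence in \<open>u\<close>, so that only \<open>u = 0\<close> and
  \<open>u = 1\<close> have to be compared, where the parity of \<open>v\<close> enters through the reflection rules.
  The same argument gives the other two formulas.
\<close>

lemma Fib_times_Luc:
  assumes "even v"
  shows "Fib u * Luc v = Fib (u + v) + Fib (u - v)"
proof -
  have "(\<lambda>u. Fib u * Luc v) = (\<lambda>u. Fib (u + v) + Fib (u - v))"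
  proof (rule two_sided_rec_unique)
    fix u
    show "Fib u * Luc v = Fib (u - 1) * Luc v + Fib (u - 2) * Luc v"
      by (subst Fib_rec[of u]) (simp add: algebra_simps)
    show "Fib (u + v) + Fib (u - v) =
        (Fib (u - 1 + v) + Fib (u - 1 - v)) + (Fib (u - 2 + v) + Fib (u - 2 - v))"
      using Fib_rec[of "u + v"] Fib_rec[of "u - v"] by (simp add: algebra_simps)
  next
    show "Fib 0 * Luc v = Fib (0 + v) + Fib (0 - v)"
      using assms by (simp add: Fib_uminus_even)
    show "Fib 1 * Luc v = Fib (1 + v) + Fib (1 - v)"
      using assms Fib_uminus_odd[of "v - 1"] by (simp add: Luc_eq_Fib_plus_Fib add.commute)
  qed
  then show ?thesis by (rule fun_cong)
qed

lemma five_Fib_times_Fib: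
  assumes "even v"
  shows "5 * Fib u * Fib v = Luc (u + v) - Luc (u - v)"
proof -
  have "(\<lambda>u. 5 * Fib u * Fib v) = (\<lambda>u. Luc (u + v) - Luc (u - v))"
  proof (rule two_sided_rec_unique)
    fix u
    show "5 * Fib u * Fib v = 5 * Fib (u - 1) * Fib v + 5 * Fib (u - 2) * Fib v"
      by (subst Fib_rec[of u]) (simp add: algebra_simps)
    show "Luc (u + v) - Luc (u - v) =
        (Luc (u - 1 + v) - Luc (u - 1 - v)) + (Luc (u - 2 + v) - Luc (u - 2 - v))"
      using Luc_rec[of "u + v"] Luc_rec[of "u - v"] by (simp add: algebra_simps)
  next
    show "5 * Fib 0 * Fib v = Luc (0 + v) - Luc (0 - v)"
      using assms by (simp add: Luc_uminus_even)
    show "5 * Fib 1 * Fib v = Luc (1 + v) - Luc (1 - v)"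
      using assms Luc_uminus_odd[of "v - 1"] by (simp add: five_Fib_eq_Luc_plus_Luc add.commute)
  qed
  then show ?thesis by (rule fun_cong)
qed

lemma Luc_times_Luc:
  assumes "even v"
  shows "Luc u * Luc v = Luc (u + v) + Luc (u - v)"
proof -
  have "(\<lambda>u. Luc u * Luc v) = (\<lambda>u. Luc (u + v) + Luc (u - v))"
  proof (rule two_sided_rec_unique)
    fix u
    show "Luc u * Luc v = Luc (u - 1) * Luc v + Luc (u - 2) * Luc v"
      by (subst Luc_rec[of u]) (simp add: algebra_simps)
    show "Luc (u + v) + Luc (u - v) =
        (Luc (u - 1 + v) + Luc (u - 1 - v)) + (Luc (u - 2 + v) + Luc (u - 2 - v))"
      using Luc_rec[of "u + v"] Luc_rec[of "u - v"] by (simp add: algebra_simps)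
  next
    show "Luc 0 * Luc v = Luc (0 + v) + Luc (0 - v)"
      using assms by (simp add: Luc_uminus_even)
    show "Luc 1 * Luc v = Luc (1 + v) + Luc (1 - v)"
      using assms Luc_uminus_odd[of "v - 1"] Luc_rec[of "v + 1"] by (simp add: add.commute)
  qed
  then show ?thesis by (rule fun_cong)
qed

lemma five_Fib_squared: "even m \<Longrightarrow> 5 * (Fib m)\<^sup>2 = Luc (2 * m) - 2"
  using five_Fib_times_Fib[of m m] by (simp add: power2_eq_square mult.assoc)

lemma Fib_triple: "even m \<Longrightarrow> Fib (3 * m) = Fib m * (Luc (2 * m) + 1)"
  using Fib_times_Luc[of "2 * m" m] by (simp add: Fib_uminus_even algebra_simps)

lemma Fib_triple_cubic: "even m \<Longrightarrow> Fib (3 * m) = 5 * (Fib m) ^ 3 + 3 * Fib m"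
proof -
  assume "even m"
  then have "Luc (2 * m) = 5 * (Fib m)\<^sup>2 + 2"
    by (simp add: five_Fib_squared)
  with \<open>even m\<close> show ?thesis
    by (simp add: Fib_triple power3_eq_cube power2_eq_square distrib_left)
qed

lemma Luc_cubed:
  assumes "even m"
  shows "(Luc m) ^ 3 = Luc (3 * m) + 3 * Luc m"
proof -
  have "(Luc m) ^ 3 = Luc m * (Luc (2 * m) + 2)"
    using Luc_times_Luc[OF assms, of m] by (simp add: power3_eq_cube mult.assoc)
  also have "\<dots> = Luc (3 * m) + 3 * Luc m"
    using assms Luc_times_Luc[of "2 * m" m] by (simp add: Luc_uminus_even algebra_simps)
  finally show ?thesis .
qed

text \<open>
  The sum telescopes, since \<open>Fib q * Luc (2 q k) = Fib ((2 k + 1) q) - Fib ((2 k - 1) q)\<close> when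
  \<open>q\<close> is even.
\<close>

lemma Fib_times_sum_Luc:
  assumes "even q"
  shows "Fib q * (\<Sum>k = 1..n. Luc (2 * q * int k)) = Fib (2 * q * int n + q) - Fib q"
proof (induction n)
  case 0
  show ?case by simp
next
  case (Suc n)
  have "Fib q * Luc (2 * q * int (Suc n)) =
      Fib (2 * q * int (Suc n) + q) + Fib (- (2 * q * int n + q))"
    using Fib_times_Luc[of "2 * q * int (Suc n)" q] by (simp add: algebra_simps)
  also have "Fib (- (2 * q * int n + q)) = - Fib (2 * q * int n + q)"
    using assms by (intro Fib_uminus_even) simp
  finally show ?case
    using Suc.IH by (simp add: distrib_left)
qed

theorem theorem3p6:
  fixes r :: int and n :: nat
  assumes "even r" and "n \<ge> 1"
  shows "Fib (3 * r) * (\<Sum>k = 1..n. Luc (2 * r * int k) ^ 3) =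
    Fib (r * int n) * Luc (r * int n + r) *
      (5 * Luc (r * int n) * Fib (r * int n + r) * Fib (2 * r * int n + r) + 4 * (Luc (2 * r) + 1))"
proof -
  define s where "s = 2 * r * int n + r"
  define c where "c = Luc (2 * r) + 1"
  have "even s" using assms by (simp add: s_def)
  have F3r: "Fib (3 * r) = Fib r * c"
    using assms by (simp add: c_def Fib_triple)
  have sum1: "Fib r * (\<Sum>k = 1..n. Luc (2 * r * int k)) = Fib s - Fib r"
    using Fib_times_sum_Luc[of r n] assms by (simp add: s_def)
  have sum3: "Fib (3 * r) * (\<Sum>k = 1..n. Luc (3 * (2 * r * int k))) = Fib (3 * s) - Fib (3 * r)"
    using Fib_times_sum_Luc[of "3 * r" n] assms by (simp add: s_def algebra_simps)
  have "Fib (3 * r) * (\<Sum>k = 1..n. Luc (2 * r * int k) ^ 3) =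
      Fib (3 * r) * (\<Sum>k = 1..n. Luc (3 * (2 * r * int k))) +
      3 * (Fib (3 * r) * (\<Sum>k = 1..n. Luc (2 * r * int k)))"
    by (simp add: Luc_cubed sum.distrib sum_distrib_left[symmetric] distrib_left)
  also have "\<dots> = Fib (3 * s) - Fib (3 * r) + 3 * (c * (Fib s - Fib r))"
    unfolding sum3 sum1[symmetric] by (simp add: F3r)
  finally have lhs: "Fib (3 * r) * (\<Sum>k = 1..n. Luc (2 * r * int k) ^ 3) =
      Fib (3 * s) + 3 * c * Fib s - 4 * (Fib r * c)"
    unfolding F3r by (simp add: algebra_simps)
  have FL: "Fib (r * int n) * Luc (r * int n + r) = Fib s - Fib r"
    using Fib_times_Luc[of "r * int n + r" "r * int n"] assms
    by (simp add: s_def Fib_uminus_even algebra_simps)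
  have LF: "Luc (r * int n) * Fib (r * int n + r) = Fib s + Fib r"
    using Fib_times_Luc[of "r * int n" "r * int n + r"] assms
    by (simp add: s_def algebra_simps)
  have sq: "5 * (Fib r)\<^sup>2 = c - 3"
    using five_Fib_squared[of r] assms by (simp add: c_def)
  have "(Fib s - Fib r) * (5 * ((Fib s + Fib r) * Fib s) + 4 * c) =
      5 * Fib s ^ 3 - (5 * (Fib r)\<^sup>2) * Fib s + 4 * c * (Fib s - Fib r)"
    by (simp add: power3_eq_cube power2_eq_square algebra_simps)
  also have "\<dots> = Fib (3 * s) + 3 * c * Fib s - 4 * (Fib r * c)"
    unfolding sq Fib_triple_cubic[OF \<open>even s\<close>] by (simp add: algebra_simps)
  finally have rhs: "(Fib s - Fib r) * (5 * ((Fib s + Fib r) * Fib s) + 4 * c) =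
      Fib (3 * s) + 3 * c * Fib s - 4 * (Fib r * c)" .
  show ?thesis
    unfolding lhs FL mult.assoc[of 5] LF s_def[symmetric] c_def[symmetric]
    by (rule rhs[symmetric])
qed

end
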